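(* Let $\alpha$ be a unit speed spacelike curve in $\mathbf{E}_1^3$ with timelike binormal, curvature $\kappa$ and torsion $\tau$, and with spacelike Darboux vector $\omega=\tau t-\kappa b$ (i.e. $|\kappa|<|\tau|$). Let $\alpha^*$ be an involute of $\alpha$ and let $\alpha^*_{n^*}=n^*$ be its principal normal spherical indicatrix. If the geodesic curvatures of the evolute curve $\alpha$ with respect to $S_1^2$ and $\mathbf{E}_1^3$, namely $$\gamma_n=\frac{\theta'}{\|\omega\|}\quad\text{and}\quad k_n=\frac{1}{\|\omega\|}\sqrt{\theta'^2+\|\omega\|^2},$$ are constant, then $\alpha^*_{n^*}$ is a geodesic on the hyperbolic sphere $H_0^2$, and in this case the natural lift $\overline{\alpha^*}_{n^*}$ of $\alpha^*_{n^*}$ is an integral curve of the geodesic spray on the tangent bundle $T(H_0^2)$. If instead $\omega$ is timelike (i.e. $|\kappa|>|\tau|$), the similar result holds with $S_1^2$ in place of $H_0^2$: if the geodesic curvatures $\gamma_n$, $k_n$ of $\alpha$ with respect to $S_1^2$ and $\mathbf{E}_1^3$ are constant, then $\alpha^*_{n^*}$ is a geodesic on $S_1^2$, and its natural lift $\overline{\alpha^*}_{n^*}$ is an integral curve of the geodesic spray on $T(S_1^2)$.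
   Context: $\mathbf{E}_1^3$ is $\mathbb{R}^3$ with the metric $g=-dx_1^2+dx_2^2+dx_3^2$; $D$ is its standard flat connection, and $\|a\|=\sqrt{|g(a,a)|}$. A vector $v$ is spacelike if $g(v,v)>0$ or $v=0$, and timelike if $g(v,v)<0$. $S_1^2=\{a: g(a,a)=1\}$ is the Lorentzian unit sphere and $H_0^2=\{a: g(a,a)=-1\}$ is the hyperbolic unit sphere. A unit speed spacelike curve $\alpha$ with timelike binormal has a Frenet frame $\{t,n,b\}$ of mutually orthogonal vectors along $\alpha$ with $t=\alpha'$, $g(t,t)=g(n,n)=1$, $g(b,b)=-1$, satisfying $t'=\kappa n$, $n'=-\kappa t+\tau b$, $b'=\tau n$. The function $\theta$ along $\alpha$ is defined as follows. If $\omega$ is spacelike: $\kappa=\|\omega\|\sinh\theta$, $\tau=\|\omega\|\cosh\theta$, with $\|\omega\|^2=\tau^2-\kappa^2$. If $\omega$ is timelike: $\kappa=\|\omega\|\cosh\theta$, $\tau=\|\omega\|\sinh\theta$, with $\|\omega\|^2=\kappa^2-\tau^2$. Primes on $\theta$ denote derivatives with respect to the arc length $s$ of $\alpha$. The geodesic curvatures $\gamma_n$ and $k_n$ of $\alpha$ are those of the curve traced by its principal normal $n$ on $S_1^2$: with unit tangent $T_n=n'/\|\omega\|$, $k_n=\|D_{T_n}T_n\|$ is the geodesic curvature with respect to $\mathbf{E}_1^3$, and $\gamma_n=\theta'/\|\omega\|$ is (up to sign) the length of the component of $D_{T_n}T_n$ tangent to $S_1^2$. For spacelike $\omega$ this gives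 the formulas displayed in the claim. An involute of $\alpha$ is a curve $\alpha^*(s)=\alpha(s)+(c-s)t(s)$, where $c$ is a real constant. The Frenet vectors of $\alpha^*$ used here satisfy: if $\omega$ is spacelike, $t^*=n$ and $n^*=\sinh\theta\,t-\cosh\theta\,b$ (timelike); if $\omega$ is timelike, $t^*=n$ and $n^*=-\cosh\theta\,t+\sinh\theta\,b$ (spacelike). The principal normal spherical indicatrix of $\alpha^*$ is the curve traced on $H_0^2$ (respectively $S_1^2$) by the vector $n^*$ translated to the origin. Let $M$ be a nondegenerate hypersurface of $\mathbf{E}_1^3$ with unit normal field $\xi$, $\varepsilon=g(\xi,\xi)$, and shape operator $S(v)=-D_v\xi$. The natural lift of a curve $\beta$ on $M$ is the curve $\overline\beta(s)=(\beta(s),\beta'(s))=\beta'(s)|_{\beta(s)}$ in $TM$, and one writes $\frac{d\overline\beta}{ds}=D_{\beta'}\beta'$. The geodesic spray is $X(v)=\varepsilon\, g(v,S(v))\,\xi$ (with $\xi$ evaluated at the base point of $v\in TM$). The natural lift $\overline\beta$ is an integral curve of $X$ if $D_{\beta'}\beta'=X(\beta')$ along $\beta$. A curve $\beta$ on $M$ is a geodesic if the covariant derivative of $\beta'$ along $\beta$ for the induced connection of $M$ vanishes.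
   Formalization: The indicatrix n* is a geodesic, and its natural lift an integral curve, when parametrized by its own arc length (for a null indicatrix: by some geodesic parameter), not by the arc length s of α; with parameter s the claim fails unless ‖ω‖ is constant. *)

theory Defs
  imports "HOL-Analysis.Analysis"
begin

section \<open>Minkowski 3-space\<close>

definition mink :: "real^3 \<Rightarrow> real^3 \<Rightarrow> real" where
  "mink x y = - (x $ 1 * y $ 1) + x $ 2 * y $ 2 + x $ 3 * y $ 3"

lemma mink_commute: "mink x y = mink y x"
  by (simp add: mink_def mult.commute)

lemma mink_simps:
  "mink (x + y) z = mink x z + mink y z" "mink z (x + y) = mink z x + mink z y"
  "mink (x - y) z = mink x z - mink y z" "mink z (x - y) = mink z x - mink z y"
  "mink (r *\<^sub>R x) z = r * mink x z" "mink z (r *\<^sub>R x) = r * mink z x"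
  "mink (- x) z = - mink x z" "mink z (- x) = - mink z x"
  by (simp_all add: mink_def algebra_simps)

definition mnorm :: "real^3 \<Rightarrow> real" where
  "mnorm a = sqrt \<bar>mink a a\<bar>"

definition spacelike :: "real^3 \<Rightarrow> bool" where
  "spacelike v \<longleftrightarrow> mink v v > 0 \<or> v = 0"

definition timelike :: "real^3 \<Rightarrow> bool" where
  "timelike v \<longleftrightarrow> mink v v < 0"

definition lorentz_sphere :: "(real^3) set" where
  "lorentz_sphere = {a. mink a a = 1}"

definition hyperbolic_sphere :: "(real^3) set" where
  "hyperbolic_sphere = {a. mink a a = -1}"

section \<open>Curves\<close>

text \<open>A curve is a function on the reals that is only considered on an open interval; a vector
  field along it is again such a function, and \<open>D\<close> along the curve is ordinary differentiation.\<close>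

definition open_interval :: "real set \<Rightarrow> bool" where
  "open_interval I \<longleftrightarrow> open I \<and> is_interval I \<and> I \<noteq> {}"

definition velocity :: "(real \<Rightarrow> real^3) \<Rightarrow> real \<Rightarrow> real^3" where
  "velocity \<beta> s = vector_derivative \<beta> (at s)"

text \<open>Unit speed spacelike curve \<open>\<alpha>\<close> with timelike binormal, together with its Frenet apparatus.
  No sign or non-vanishing condition is imposed on \<open>\<kappa>\<close>.\<close>

definition frenet_timelike_binormal ::
  "real set \<Rightarrow> (real \<Rightarrow> real^3) \<Rightarrow> (real \<Rightarrow> real^3) \<Rightarrow> (real \<Rightarrow> real^3) \<Rightarrow> (real \<Rightarrow> real^3)
    \<Rightarrow> (real \<Rightarrow> real) \<Rightarrow> (real \<Rightarrow> real) \<Rightarrow> bool" where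
  "frenet_timelike_binormal I \<alpha> t n b \<kappa> \<tau> \<longleftrightarrow>
    (\<forall>s\<in>I. (\<alpha> has_vector_derivative t s) (at s)
      \<and> mink (t s) (t s) = 1 \<and> mink (n s) (n s) = 1 \<and> mink (b s) (b s) = -1
      \<and> mink (t s) (n s) = 0 \<and> mink (t s) (b s) = 0 \<and> mink (n s) (b s) = 0
      \<and> (t has_vector_derivative \<kappa> s *\<^sub>R n s) (at s)
      \<and> (n has_vector_derivative - \<kappa> s *\<^sub>R t s + \<tau> s *\<^sub>R b s) (at s)
      \<and> (b has_vector_derivative \<tau> s *\<^sub>R n s) (at s)
      \<and> \<kappa> differentiable (at s) \<and> \<tau> differentiable (at s))"

definition darboux ::
  "(real \<Rightarrow> real^3) \<Rightarrow> (real \<Rightarrow> real^3) \<Rightarrow> (real \<Rightarrow> real) \<Rightarrow> (real \<Rightarrow> real) \<Rightarrow> real \<Rightarrow> real^3" where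
  "darboux t b \<kappa> \<tau> s = \<tau> s *\<^sub>R t s - \<kappa> s *\<^sub>R b s"

section \<open>Geodesic curvatures of the curve traced by the principal normal\<close>

text \<open>The unit tangent \<open>T\<^sub>n = n' / \<parallel>\<omega>\<parallel>\<close>, and \<open>D\<^bsub>T\<^sub>n\<^esub> T\<^sub>n\<close>: since \<open>\<parallel>n'\<parallel> = \<parallel>\<omega>\<parallel>\<close>, differentiating
  in direction \<open>T\<^sub>n\<close> is \<open>d/ds\<close> divided by \<open>\<parallel>\<omega>\<parallel>\<close>.\<close>

definition normal_tangent :: "(real \<Rightarrow> real^3) \<Rightarrow> (real \<Rightarrow> real^3) \<Rightarrow> real \<Rightarrow> real^3" where
  "normal_tangent \<omega> n s = (1 / mnorm (\<omega> s)) *\<^sub>R velocity n s"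

definition normal_acceleration :: "(real \<Rightarrow> real^3) \<Rightarrow> (real \<Rightarrow> real^3) \<Rightarrow> real \<Rightarrow> real^3" where
  "normal_acceleration \<omega> n s = (1 / mnorm (\<omega> s)) *\<^sub>R velocity (normal_tangent \<omega> n) s"

definition geod_curv_E :: "(real \<Rightarrow> real^3) \<Rightarrow> (real \<Rightarrow> real^3) \<Rightarrow> real \<Rightarrow> real" where
  "geod_curv_E \<omega> n s = mnorm (normal_acceleration \<omega> n s)"

definition geod_curv_S :: "(real \<Rightarrow> real^3) \<Rightarrow> (real \<Rightarrow> real) \<Rightarrow> real \<Rightarrow> real" where
  "geod_curv_S \<omega> \<theta> s = deriv \<theta> s / mnorm (\<omega> s)"

text \<open>For spacelike \<open>\<omega>\<close> the definition of \<open>k\<^sub>n\<close> gives the familiar formula.\<close>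

lemma normal_acceleration_spacelike:
  assumes I: "open_interval I" "s \<in> I" and fr: "frenet_timelike_binormal I \<alpha> t n b \<kappa> \<tau>"
    and w: "\<forall>s\<in>I. mink (\<omega> s) (\<omega> s) > 0"
    and \<theta>: "\<forall>s\<in>I. \<kappa> s = mnorm (\<omega> s) * sinh (\<theta> s) \<and> \<tau> s = mnorm (\<omega> s) * cosh (\<theta> s)"
    and diff: "\<theta> differentiable (at s)"
  shows "normal_acceleration \<omega> n s
    = geod_curv_S \<omega> \<theta> s *\<^sub>R (- cosh (\<theta> s) *\<^sub>R t s + sinh (\<theta> s) *\<^sub>R b s) + n s"
proof -
  have pos: "mnorm (\<omega> u) > 0" if "u \<in> I" for u using w that by (auto simp: mnorm_def)
  have n': "velocity n u = - \<kappa> u *\<^sub>R t u + \<tau> u *\<^sub>R b u" if "u \<in> I" for u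
    using fr that by (auto simp: velocity_def frenet_timelike_binormal_def
      intro!: vector_derivative_at)
  have T: "normal_tangent \<omega> n u = - sinh (\<theta> u) *\<^sub>R t u + cosh (\<theta> u) *\<^sub>R b u" if "u \<in> I" for u
    using pos[OF that] \<theta> that by (simp add: normal_tangent_def n' algebra_simps)
  have \<theta>': "(\<theta> has_real_derivative deriv \<theta> s) (at s)"
    using diff by (simp add: DERIV_deriv_iff_real_differentiable)
  have tb: "(t has_vector_derivative \<kappa> s *\<^sub>R n s) (at s)" "(b has_vector_derivative \<tau> s *\<^sub>R n s) (at s)"
    using fr I by (auto simp: frenet_timelike_binormal_def)
  have "((\<lambda>u. - sinh (\<theta> u) *\<^sub>R t u + cosh (\<theta> u) *\<^sub>R b u) has_vector_derivative
      deriv \<theta> s *\<^sub>R (- cosh (\<theta> s) *\<^sub>R t s + sinh (\<theta> s) *\<^sub>R b s)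
        + (- sinh (\<theta> s) * \<kappa> s + cosh (\<theta> s) * \<tau> s) *\<^sub>R n s) (at s)"
    by (rule has_vector_derivative_eq_rhs, (rule derivative_intros tb \<theta>')+)
       (simp add: algebra_simps)
  moreover have "- sinh (\<theta> s) * \<kappa> s + cosh (\<theta> s) * \<tau> s = mnorm (\<omega> s)"
  proof -
    have "- sinh (\<theta> s) * \<kappa> s + cosh (\<theta> s) * \<tau> s
        = mnorm (\<omega> s) * ((cosh (\<theta> s))\<^sup>2 - (sinh (\<theta> s))\<^sup>2)"
      using \<theta> I(2) by (simp add: algebra_simps power2_eq_square)
    then show ?thesis by (simp add: hyperbolic_pythagoras)
  qed
  ultimately have "((\<lambda>u. - sinh (\<theta> u) *\<^sub>R t u + cosh (\<theta> u) *\<^sub>R b u) has_vector_derivative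
      deriv \<theta> s *\<^sub>R (- cosh (\<theta> s) *\<^sub>R t s + sinh (\<theta> s) *\<^sub>R b s) + mnorm (\<omega> s) *\<^sub>R n s) (at s)"
    by simp
  then have "(normal_tangent \<omega> n has_vector_derivative
      deriv \<theta> s *\<^sub>R (- cosh (\<theta> s) *\<^sub>R t s + sinh (\<theta> s) *\<^sub>R b s) + mnorm (\<omega> s) *\<^sub>R n s) (at s)"
    by (rule has_vector_derivative_transform_within_open[where S = I])
       (use I T in \<open>auto simp: open_interval_def\<close>)
  then have "velocity (normal_tangent \<omega> n) s
      = deriv \<theta> s *\<^sub>R (- cosh (\<theta> s) *\<^sub>R t s + sinh (\<theta> s) *\<^sub>R b s) + mnorm (\<omega> s) *\<^sub>R n s"
    unfolding velocity_def by (rule vector_derivative_at)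
  then show ?thesis
    using pos[OF I(2)]
    by (simp add: normal_acceleration_def geod_curv_S_def scaleR_right_distrib)
qed

lemma geod_curv_E_spacelike:
  assumes I: "open_interval I" "s \<in> I" and fr: "frenet_timelike_binormal I \<alpha> t n b \<kappa> \<tau>"
    and w: "\<forall>s\<in>I. mink (\<omega> s) (\<omega> s) > 0"
    and \<theta>: "\<forall>s\<in>I. \<kappa> s = mnorm (\<omega> s) * sinh (\<theta> s) \<and> \<tau> s = mnorm (\<omega> s) * cosh (\<theta> s)"
    and diff: "\<theta> differentiable (at s)"
  shows "geod_curv_E \<omega> n s = 1 / mnorm (\<omega> s) * sqrt ((deriv \<theta> s)\<^sup>2 + (mnorm (\<omega> s))\<^sup>2)"
proof -
  have pos: "mnorm (\<omega> s) > 0" using w I by (auto simp: mnorm_def)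
  have a: "mink (t s) (t s) = 1" "mink (n s) (n s) = 1" "mink (b s) (b s) = -1"
      "mink (t s) (n s) = 0" "mink (t s) (b s) = 0" "mink (n s) (b s) = 0"
    using fr I by (auto simp: frenet_timelike_binormal_def)
  let ?g = "geod_curv_S \<omega> \<theta> s"
  let ?B = "- cosh (\<theta> s) *\<^sub>R t s + sinh (\<theta> s) *\<^sub>R b s"
  have "mink ?B ?B = (cosh (\<theta> s))\<^sup>2 - (sinh (\<theta> s))\<^sup>2"
    by (simp add: mink_simps a mink_commute[of "b s" "t s"] power2_eq_square)
  then have BB: "mink ?B ?B = 1" by (simp add: hyperbolic_pythagoras)
  have Bn: "mink ?B (n s) = 0" by (simp add: mink_simps a mink_commute[of "b s" "n s"])
  have "mink (?g *\<^sub>R ?B + n s) (?g *\<^sub>R ?B + n s)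
      = ?g\<^sup>2 * mink ?B ?B + 2 * ?g * mink ?B (n s) + mink (n s) (n s)"
    by (simp only: mink_simps(1,2,5,6) mink_commute[of "n s" ?B]) (simp add: mink_simps algebra_simps power2_eq_square mink_commute)
  then have "geod_curv_E \<omega> n s = sqrt (?g\<^sup>2 + 1)"
    using a(2) BB Bn by (simp add: geod_curv_E_def mnorm_def normal_acceleration_spacelike[OF assms])
  also have "?g\<^sup>2 + 1 = (1 / mnorm (\<omega> s))\<^sup>2 * ((deriv \<theta> s)\<^sup>2 + (mnorm (\<omega> s))\<^sup>2)"
    using pos by (simp add: geod_curv_S_def field_simps)
  finally show ?thesis using pos by (simp add: real_sqrt_mult)
qed

section \<open>Involutes\<close>

definition involute :: "(real \<Rightarrow> real^3) \<Rightarrow> (real \<Rightarrow> real^3) \<Rightarrow> real \<Rightarrow> real \<Rightarrow> real^3" where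
  "involute \<alpha> t c s = \<alpha> s + (c - s) *\<^sub>R t s"

text \<open>\<open>T\<close> and \<open>N\<close> are tangent and principal normal of the curve \<open>\<gamma>\<close>, which need not have unit
  speed. The factors \<open>v\<close> and \<open>k\<close> may have any sign and may vanish, because an involute is singular
  at \<open>s = c\<close> and because the orientation of its frame is fixed by a separate convention.\<close>

definition tangent_normal_frame ::
  "real set \<Rightarrow> (real \<Rightarrow> real^3) \<Rightarrow> (real \<Rightarrow> real^3) \<Rightarrow> (real \<Rightarrow> real^3) \<Rightarrow> bool" where
  "tangent_normal_frame I \<gamma> T N \<longleftrightarrow>
    (\<forall>s\<in>I. mnorm (T s) = 1 \<and> mnorm (N s) = 1 \<and> mink (T s) (N s) = 0
      \<and> (\<exists>v. (\<gamma> has_vector_derivative v *\<^sub>R T s) (at s))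
      \<and> (\<exists>k. (T has_vector_derivative k *\<^sub>R N s) (at s)))"

text \<open>The assumptions made on tangent and principal normal of the involute hold automatically.\<close>

lemma tangent_normal_frame_involute_spacelike:
  assumes "frenet_timelike_binormal I \<alpha> t n b \<kappa> \<tau>"
    and "\<forall>s\<in>I. \<kappa> s = w s * sinh (\<theta> s) \<and> \<tau> s = w s * cosh (\<theta> s)"
  shows "tangent_normal_frame I (involute \<alpha> t c) n (\<lambda>s. sinh (\<theta> s) *\<^sub>R t s - cosh (\<theta> s) *\<^sub>R b s)"
  unfolding tangent_normal_frame_def
proof (intro ballI conjI)
  fix s assume "s \<in> I"
  with assms have a: "(\<alpha> has_vector_derivative t s) (at s)"
      "mink (t s) (t s) = 1" "mink (n s) (n s) = 1" "mink (b s) (b s) = -1"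
      "mink (t s) (n s) = 0" "mink (t s) (b s) = 0" "mink (n s) (b s) = 0"
      "(t has_vector_derivative \<kappa> s *\<^sub>R n s) (at s)"
      "(n has_vector_derivative - \<kappa> s *\<^sub>R t s + \<tau> s *\<^sub>R b s) (at s)"
      "\<kappa> s = w s * sinh (\<theta> s)" "\<tau> s = w s * cosh (\<theta> s)"
    by (auto simp: frenet_timelike_binormal_def)
  show "mnorm (n s) = 1" by (simp add: mnorm_def a)
  show "mnorm (sinh (\<theta> s) *\<^sub>R t s - cosh (\<theta> s) *\<^sub>R b s) = 1"
    using cosh_square_eq[of "\<theta> s"] by (simp add: mnorm_def mink_simps a power2_eq_square mink_commute[of "b s" "t s"])
  show "mink (n s) (sinh (\<theta> s) *\<^sub>R t s - cosh (\<theta> s) *\<^sub>R b s) = 0"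
    by (simp add: mink_simps a mink_commute[of "n s" "t s"])
  show "\<exists>v. (involute \<alpha> t c has_vector_derivative v *\<^sub>R n s) (at s)"
    by (rule exI[of _ "(c - s) * \<kappa> s"], unfold involute_def, rule has_vector_derivative_eq_rhs,
        (rule derivative_intros a)+, simp)
  have "- \<kappa> s *\<^sub>R t s + \<tau> s *\<^sub>R b s
      = (- w s) *\<^sub>R (sinh (\<theta> s) *\<^sub>R t s - cosh (\<theta> s) *\<^sub>R b s)"
    by (simp add: a algebra_simps)
  then show "\<exists>k. (n has_vector_derivative k *\<^sub>R (sinh (\<theta> s) *\<^sub>R t s - cosh (\<theta> s) *\<^sub>R b s)) (at s)"
    using a(9) by metis
qed

lemma tangent_normal_frame_involute_timelike:
  assumes "frenet_timelike_binormal I \<alpha> t n b \<kappa> \<tau>"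
    and "\<forall>s\<in>I. \<kappa> s = w s * cosh (\<theta> s) \<and> \<tau> s = w s * sinh (\<theta> s)"
  shows "tangent_normal_frame I (involute \<alpha> t c) n (\<lambda>s. - cosh (\<theta> s) *\<^sub>R t s + sinh (\<theta> s) *\<^sub>R b s)"
  unfolding tangent_normal_frame_def
proof (intro ballI conjI)
  fix s assume "s \<in> I"
  with assms have a: "(\<alpha> has_vector_derivative t s) (at s)"
      "mink (t s) (t s) = 1" "mink (n s) (n s) = 1" "mink (b s) (b s) = -1"
      "mink (t s) (n s) = 0" "mink (t s) (b s) = 0" "mink (n s) (b s) = 0"
      "(t has_vector_derivative \<kappa> s *\<^sub>R n s) (at s)"
      "(n has_vector_derivative - \<kappa> s *\<^sub>R t s + \<tau> s *\<^sub>R b s) (at s)"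
      "\<kappa> s = w s * cosh (\<theta> s)" "\<tau> s = w s * sinh (\<theta> s)"
    by (auto simp: frenet_timelike_binormal_def)
  show "mnorm (n s) = 1" by (simp add: mnorm_def a)
  show "mnorm (- cosh (\<theta> s) *\<^sub>R t s + sinh (\<theta> s) *\<^sub>R b s) = 1"
    using cosh_square_eq[of "\<theta> s"]
    by (simp add: mnorm_def mink_simps a power2_eq_square mink_commute[of "b s" "t s"])
  show "mink (n s) (- cosh (\<theta> s) *\<^sub>R t s + sinh (\<theta> s) *\<^sub>R b s) = 0"
    by (simp add: mink_simps a mink_commute[of "n s" "t s"])
  show "\<exists>v. (involute \<alpha> t c has_vector_derivative v *\<^sub>R n s) (at s)"
    by (rule exI[of _ "(c - s) * \<kappa> s"], unfold involute_def, rule has_vector_derivative_eq_rhs,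
        (rule derivative_intros a)+, simp)
  have "- \<kappa> s *\<^sub>R t s + \<tau> s *\<^sub>R b s
      = w s *\<^sub>R (- cosh (\<theta> s) *\<^sub>R t s + sinh (\<theta> s) *\<^sub>R b s)"
    by (simp add: a algebra_simps)
  then show "\<exists>k. (n has_vector_derivative k *\<^sub>R (- cosh (\<theta> s) *\<^sub>R t s + sinh (\<theta> s) *\<^sub>R b s)) (at s)"
    using a(9) by metis
qed

section \<open>Geodesics and the geodesic spray of a hypersurface\<close>

text \<open>A hypersurface is given by its set of points \<open>M\<close> and a unit normal field \<open>\<xi>\<close> that is defined
  and differentiable near \<open>M\<close>; its tangent space at \<open>p\<close> is the orthogonal complement of \<open>\<xi> p\<close>.
  On both unit spheres \<open>\<xi> = id\<close>, with \<open>\<epsilon> = -1\<close> on the hyperbolic and \<open>\<epsilon> = 1\<close> on the Lorentzian one.\<close>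

definition normal_sign :: "(real^3 \<Rightarrow> real^3) \<Rightarrow> real^3 \<Rightarrow> real" where
  "normal_sign \<xi> p = mink (\<xi> p) (\<xi> p)"

definition tangent_bundle :: "(real^3) set \<Rightarrow> (real^3 \<Rightarrow> real^3) \<Rightarrow> ((real^3) \<times> (real^3)) set" where
  "tangent_bundle M \<xi> = {(p, v). p \<in> M \<and> mink v (\<xi> p) = 0}"

definition shape_operator :: "(real^3 \<Rightarrow> real^3) \<Rightarrow> real^3 \<Rightarrow> real^3 \<Rightarrow> real^3" where
  "shape_operator \<xi> p v = - frechet_derivative \<xi> (at p) v"

definition geodesic_spray :: "(real^3 \<Rightarrow> real^3) \<Rightarrow> (real^3) \<times> (real^3) \<Rightarrow> real^3" where
  "geodesic_spray \<xi> = (\<lambda>(p, v). (normal_sign \<xi> p * mink v (shape_operator \<xi> p v)) *\<^sub>R \<xi> p)"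

definition natural_lift :: "(real \<Rightarrow> real^3) \<Rightarrow> real \<Rightarrow> (real^3) \<times> (real^3)" where
  "natural_lift \<beta> s = (\<beta> s, velocity \<beta> s)"

text \<open>For a lift \<open>L = (\<beta>, \<beta>')\<close> the derivative \<open>dL/ds\<close> is by convention \<open>D\<^bsub>\<beta>'\<^esub> \<beta>'\<close>, the derivative of its
  vector component; this is what the spray prescribes.\<close>

definition spray_integral_curve ::
  "(real^3) set \<Rightarrow> (real^3 \<Rightarrow> real^3) \<Rightarrow> (real \<Rightarrow> (real^3) \<times> (real^3)) \<Rightarrow> real set \<Rightarrow> bool" where
  "spray_integral_curve M \<xi> L J \<longleftrightarrow>
    (\<forall>u\<in>J. L u \<in> tangent_bundle M \<xi>
      \<and> ((\<lambda>x. snd (L x)) has_vector_derivative geodesic_spray \<xi> (L u)) (at u))"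

text \<open>Covariant derivative along \<open>\<beta>\<close> for the induced connection: the tangential part of \<open>D\<close>.\<close>

definition induced_covariant ::
  "(real^3 \<Rightarrow> real^3) \<Rightarrow> (real \<Rightarrow> real^3) \<Rightarrow> (real \<Rightarrow> real^3) \<Rightarrow> real \<Rightarrow> real^3" where
  "induced_covariant \<xi> \<beta> Y u =
    vector_derivative Y (at u)
      - (normal_sign \<xi> (\<beta> u) * mink (vector_derivative Y (at u)) (\<xi> (\<beta> u))) *\<^sub>R \<xi> (\<beta> u)"

definition geodesic_on ::
  "(real^3) set \<Rightarrow> (real^3 \<Rightarrow> real^3) \<Rightarrow> (real \<Rightarrow> real^3) \<Rightarrow> real set \<Rightarrow> bool" where
  "geodesic_on M \<xi> \<beta> J \<longleftrightarrow>
    (\<forall>u\<in>J. \<beta> u \<in> M \<and> \<beta> differentiable (at u) \<and> velocity \<beta> differentiable (at u)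
      \<and> induced_covariant \<xi> \<beta> (velocity \<beta>) u = 0)"

section \<open>Geodesics as traced curves\<close>

text \<open>The vanishing of the covariant derivative depends on the parametrization, and the arc length
  \<open>s\<close> of \<open>\<alpha>\<close> is in general not an affine parameter of the indicatrix. So the indicatrix is taken
  with its own arc length parameter.\<close>

definition reparametrization ::
  "(real \<Rightarrow> real^3) \<Rightarrow> real set \<Rightarrow> (real \<Rightarrow> real^3) \<Rightarrow> real set \<Rightarrow> bool" where
  "reparametrization c I \<beta> J \<longleftrightarrow> open_interval J \<and>
    (\<exists>\<phi>. \<phi> ` J = I \<and> (\<forall>u\<in>J. (\<exists>d>0. (\<phi> has_real_derivative d) (at u)) \<and> \<beta> u = c (\<phi> u)))"

definition unit_speed :: "(real \<Rightarrow> real^3) \<Rightarrow> real set \<Rightarrow> bool" where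
  "unit_speed \<beta> J \<longleftrightarrow> (\<forall>u\<in>J. mnorm (velocity \<beta> u) = 1)"

definition null_curve :: "(real \<Rightarrow> real^3) \<Rightarrow> real set \<Rightarrow> bool" where
  "null_curve \<beta> J \<longleftrightarrow> (\<forall>u\<in>J. mink (velocity \<beta> u) (velocity \<beta> u) = 0)"

text \<open>The curve traced by \<open>c\<close> is a geodesic: its arc length parametrizations are. A null curve (which
  can occur on the Lorentzian sphere) has no arc length; it is a geodesic if some parametrization is.\<close>

definition traces_geodesic ::
  "(real^3) set \<Rightarrow> (real^3 \<Rightarrow> real^3) \<Rightarrow> (real \<Rightarrow> real^3) \<Rightarrow> real set \<Rightarrow> bool" where
  "traces_geodesic M \<xi> c I \<longleftrightarrow> c ` I \<subseteq> M
    \<and> (\<exists>\<beta> J. reparametrization c I \<beta> J \<and> (unit_speed \<beta> J \<or> null_curve \<beta> J) \<and> geodesic_on M \<xi> \<beta> J)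
    \<and> (\<forall>\<beta> J. reparametrization c I \<beta> J \<and> unit_speed \<beta> J \<longrightarrow> geodesic_on M \<xi> \<beta> J)"

text \<open>The natural lift of the curve traced by \<open>c\<close>, in every parametrization that makes it a geodesic
  (in particular by arc length).\<close>

definition lift_integral_curve ::
  "(real^3) set \<Rightarrow> (real^3 \<Rightarrow> real^3) \<Rightarrow> (real \<Rightarrow> real^3) \<Rightarrow> real set \<Rightarrow> bool" where
  "lift_integral_curve M \<xi> c I \<longleftrightarrow>
    (\<forall>\<beta> J. reparametrization c I \<beta> J \<and> geodesic_on M \<xi> \<beta> J
      \<longrightarrow> spray_integral_curve M \<xi> (natural_lift \<beta>) J)"

end

(* The tangent direction of the indicatrix N = n* is V = \<gamma>\<^sub>n C - n, where C is the third vector of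
   the orthogonal frame containing N and n: if \<gamma>\<^sub>n is constant then N' = \<parallel>\<omega>\<parallel> V and V' is a
   multiple of \<parallel>\<omega>\<parallel> N with constant factor, so that after reparametrizing N'' is proportional to N,
   which is normal to the unit sphere. The number g(V,V) = q is constant; an arc length parameter exists
   iff q \<noteq> 0, and q = 0 is the null case. That the lift of a geodesic is an integral curve of the spray
   follows by differentiating g(\<beta>,\<beta>) = \<epsilon> twice. *)
theory Submission
  imports Defs
begin

section \<open>Differentiating the Minkowski form\<close>

lemma bounded_bilinear_mink: "bounded_bilinear mink"
  unfolding bilinear_conv_bounded_bilinear[symmetric] bilinear_def
  by (auto intro!: linearI simp: mink_simps)

text \<open>In finite dimension every bilinear map is bounded, so the product rule is available for
  an indefinite form as well.\<close>

lemmas has_vector_derivative_mink = bounded_bilinear.has_vector_derivative[OF bounded_bilinear_mink]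

lemma mnorm_scaleR: "mnorm (r *\<^sub>R v) = \<bar>r\<bar> * mnorm v"
proof -
  have "mink (r *\<^sub>R v) (r *\<^sub>R v) = r\<^sup>2 * mink v v"
    by (simp add: mink_simps power2_eq_square)
  then show ?thesis by (simp add: mnorm_def abs_mult real_sqrt_mult)
qed

section \<open>Antiderivatives and changes of parameter on an open interval\<close>

lemma antiderivative_open_interval:
  fixes f :: "real \<Rightarrow> real"
  assumes I: "open_interval I" and f: "continuous_on I f"
  obtains F where "\<And>x. x \<in> I \<Longrightarrow> (F has_real_derivative f x) (at x)"
proof -
  obtain a where a: "a \<in> I" using I by (auto simp: open_interval_def)
  \<comment> \<open>The signed integral from the base point \<open>a\<close>: at least one of the
    two intervals is empty or a single point, and its integral is 0.\<close>
  define F where "F x = integral {a..x} f - integral {x..a} f" for x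
  have "(F has_real_derivative f x) (at x)" if x: "x \<in> I" for x
  proof -
    have oI: "open I" and iI: "is_interval I" using I by (auto simp: open_interval_def)
    \<comment> \<open>Points \<open>p\<close> and \<open>r\<close> of \<open>I\<close> are chosen
      beyond both \<open>a\<close> and \<open>x\<close>, so that \<open>x\<close> is interior to one
      compact interval on which the fundamental theorem of calculus applies. There \<open>F\<close>
      differs from the integral starting at \<open>p\<close> by a constant.\<close>
    have "min a x \<in> I" "max a x \<in> I" using a x by (auto simp: min_def max_def)
    then obtain d e where d: "d > 0" "ball (min a x) d \<subseteq> I" and e: "e > 0" "ball (max a x) e \<subseteq> I"
      using oI by (meson open_contains_ball)
    define p where "p = min a x - d / 2"
    define r where "r = max a x + e / 2"
    have "p \<in> ball (min a x) d" "r \<in> ball (max a x) e"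
      using d(1) e(1) by (simp_all add: p_def r_def dist_real_def)
    then have p: "p \<in> I" "p < a" "p < x" and r: "r \<in> I" "a < r" "x < r"
      using d e by (auto simp: p_def r_def)
    have sub: "{p..r} \<subseteq> I"
      using iI p(1) r(1) unfolding is_interval_1 by (meson atLeastAtMost_iff subsetI)
    then have c: "continuous_on {p..r} f" using f continuous_on_subset by blast
    have int: "f integrable_on {u..v}" if "p \<le> u" "v \<le> r" for u v
      using c that by (intro integrable_continuous_real continuous_on_subset[OF c]) auto
    have F: "F y = integral {p..y} f - integral {p..a} f" if y: "y \<in> {p<..<r}" for y
    proof (cases "a \<le> y")
      case True
      then have "integral {p..a} f + integral {a..y} f = integral {p..y} f"
        using y p by (intro Henstock_Kurzweil_Integration.integral_combine int) auto
      moreover have "integral {y..a} f = 0" using True by (cases "a = y") auto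
      ultimately show ?thesis by (simp add: F_def)
    next
      case False
      then have "integral {p..y} f + integral {y..a} f = integral {p..a} f"
        using y r by (intro Henstock_Kurzweil_Integration.integral_combine int) auto
      then show ?thesis using False by (simp add: F_def)
    qed
    have "((\<lambda>y. integral {p..y} f) has_real_derivative f x) (at x within {p..r})"
      using integral_has_real_derivative[OF c, of x] p r by simp
    then have "((\<lambda>y. integral {p..y} f) has_real_derivative f x) (at x)"
      using p r by (simp add: at_within_Icc_at)
    then have "((\<lambda>y. integral {p..y} f - integral {p..a} f) has_real_derivative f x) (at x)"
      by (auto intro!: derivative_eq_intros)
    then show ?thesis
      by (rule has_field_derivative_transform_within_open[where S = "{p<..<r}"]) (use p r F in auto)
  qed
  then show ?thesis using that by blast
qed

text \<open>The autonomous equation for \<open>\<phi>\<close> is separable: its solution is the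
  inverse of an antiderivative \<open>F\<close> of \<open>W\<close>, which is strictly increasing
  because \<open>W\<close> is positive.\<close>

lemma reparametrization_exists:
  fixes W :: "real \<Rightarrow> real"
  assumes I: "open_interval I" and W: "continuous_on I W" and pos: "\<And>s. s \<in> I \<Longrightarrow> W s > 0"
  shows "\<exists>\<phi> J. open_interval J \<and> \<phi> ` J = I
    \<and> (\<forall>u\<in>J. (\<phi> has_real_derivative 1 / W (\<phi> u)) (at u))"
proof -
  obtain F where F: "\<And>x. x \<in> I \<Longrightarrow> (F has_real_derivative W x) (at x)"
    using antiderivative_open_interval[OF I W] by blast
  have oI: "open I" and iI: "is_interval I" and ne: "I \<noteq> {}" using I by (auto simp: open_interval_def)
  have less: "F x < F y" if "x \<in> I" "y \<in> I" "x < y" for x y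
    using that(3)
  proof (rule DERIV_pos_imp_increasing)
    fix z assume "x \<le> z" "z \<le> y"
    then have "z \<in> I" using iI that unfolding is_interval_1 by blast
    then show "\<exists>d. (F has_real_derivative d) (at z) \<and> d > 0" using F pos by blast
  qed
  have inj: "inj_on F I" by (rule inj_onI) (metis less less_irrefl linorder_neqE)
  have cont: "continuous_on I F"
    using F by (meson DERIV_isCont continuous_at_imp_continuous_on)
  define \<phi> where "\<phi> = the_inv_into I F"
  have \<phi>: "\<phi> (F x) = x" if "x \<in> I" for x
    unfolding \<phi>_def using inj that by (rule the_inv_into_f_f)
  show ?thesis
  proof (intro exI conjI ballI)
    \<comment> \<open>The new parameter domain is the image of \<open>I\<close> under
      \<open>F\<close>: open by injectivity and continuity, an interval by connectedness.\<close>
    have "open (F ` I)" using cont oI inj by (rule invariance_of_domain)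
    moreover have "is_interval (F ` I)"
      using cont iI connected_continuous_image is_interval_connected_1 by blast
    ultimately show "open_interval (F ` I)" using ne by (simp add: open_interval_def)
    show "\<phi> ` F ` I = I" using \<phi> by (force simp: image_image)
    show "(\<phi> has_real_derivative 1 / W (\<phi> u)) (at u)" if "u \<in> F ` I" for u
    proof -
      from that obtain x where x: "x \<in> I" "u = F x" by auto
      have "(\<phi> has_derivative (*) (1 / W x)) (at (F x))"
        using oI x(1) cont \<phi> F[OF x(1), unfolded has_field_derivative_def]
        by (rule has_derivative_inverse_strong) (use pos[OF x(1)] in \<open>auto simp: fun_eq_iff\<close>)
      then show ?thesis using x \<phi> by (simp add: has_field_derivative_def)
    qed
  qed
qed

section \<open>Geodesics and the geodesic spray on a unit sphere of either sign\<close>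

locale unit_sphere =
  fixes M :: "(real^3) set" and \<epsilon> :: real
  assumes M: "M = {a. mink a a = \<epsilon>}" and eps: "\<epsilon> * \<epsilon> = 1"
begin

text \<open>The position vector is normal to the sphere: differentiate the constant
  \<open>mink (\<beta> x) (\<beta> x)\<close>.\<close>

lemma mink_velocity_eq_0:
  assumes "open_interval J" "\<And>x. x \<in> J \<Longrightarrow> \<beta> x \<in> M" "u \<in> J" "\<beta> differentiable (at u)"
  shows "mink (velocity \<beta> u) (\<beta> u) = 0"
proof -
  have "(\<beta> has_vector_derivative velocity \<beta> u) (at u)"
    using assms(4) by (simp add: velocity_def vector_derivative_works)
  then have "((\<lambda>x. mink (\<beta> x) (\<beta> x)) has_vector_derivative
      mink (\<beta> u) (velocity \<beta> u) + mink (velocity \<beta> u) (\<beta> u)) (at u)"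
    by (intro has_vector_derivative_mink)
  moreover have "((\<lambda>x. mink (\<beta> x) (\<beta> x)) has_vector_derivative 0) (at u)"
    by (rule has_vector_derivative_transform_within_open[OF has_vector_derivative_const, of J _ \<epsilon>])
       (use assms M in \<open>auto simp: open_interval_def\<close>)
  ultimately show ?thesis
    using vector_derivative_unique_at mink_commute by fastforce
qed

text \<open>Differentiating the orthogonality of velocity and position determines the normal
  component of the acceleration, and a geodesic has no tangential one. For the normal field
  \<open>id\<close> the shape operator is minus the identity, so the spray prescribes exactly this
  vector.\<close>

lemma geodesic_imp_spray_integral_curve:
  assumes J: "open_interval J" and geo: "geodesic_on M id \<beta> J"
  shows "spray_integral_curve M id (natural_lift \<beta>) J"
  unfolding spray_integral_curve_def
proof (intro ballI conjI)
  fix u assume u: "u \<in> J"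
  have \<beta>: "\<beta> x \<in> M" "\<beta> differentiable (at x)" "velocity \<beta> differentiable (at x)" if "x \<in> J" for x
    using geo that by (auto simp: geodesic_on_def)
  have tangent: "mink (velocity \<beta> x) (\<beta> x) = 0" if "x \<in> J" for x
    using mink_velocity_eq_0[OF J] \<beta> that by blast
  show "natural_lift \<beta> u \<in> tangent_bundle M id"
    using \<beta>(1) tangent u by (simp add: natural_lift_def tangent_bundle_def)
  define A where "A = vector_derivative (velocity \<beta>) (at u)"
  have A: "(velocity \<beta> has_vector_derivative A) (at u)"
    using \<beta>(3)[OF u] by (simp add: A_def vector_derivative_works)
  moreover have "(\<beta> has_vector_derivative velocity \<beta> u) (at u)"
    using \<beta>(2)[OF u] by (simp add: velocity_def vector_derivative_works)
  ultimately have "((\<lambda>x. mink (velocity \<beta> x) (\<beta> x)) has_vector_derivative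
      mink (velocity \<beta> u) (velocity \<beta> u) + mink A (\<beta> u)) (at u)"
    by (intro has_vector_derivative_mink)
  moreover have "((\<lambda>x. mink (velocity \<beta> x) (\<beta> x)) has_vector_derivative 0) (at u)"
    by (rule has_vector_derivative_transform_within_open[OF has_vector_derivative_const, of J _ 0])
       (use J u tangent in \<open>auto simp: open_interval_def\<close>)
  ultimately have "mink (velocity \<beta> u) (velocity \<beta> u) + mink A (\<beta> u) = 0"
    using vector_derivative_unique_at by blast
  then have "mink A (\<beta> u) = - mink (velocity \<beta> u) (velocity \<beta> u)" by simp
  moreover have "A = (normal_sign id (\<beta> u) * mink A (\<beta> u)) *\<^sub>R \<beta> u"
    using geo u by (simp add: geodesic_on_def induced_covariant_def A_def)
  ultimately have "A = geodesic_spray id (natural_lift \<beta> u)"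
    by (simp add: geodesic_spray_def natural_lift_def shape_operator_def mink_simps
        frechet_derivative_id[unfolded id_def[symmetric]])
  then show "((\<lambda>x. snd (natural_lift \<beta> x)) has_vector_derivative
      geodesic_spray id (natural_lift \<beta> u)) (at u)"
    using A by (simp add: natural_lift_def)
qed

text \<open>Only parametrizations that are already geodesics enter the definition, so the previous
  lemma covers all of them, whatever curve \<open>N\<close> is.\<close>

lemma lift_integral_curve: "lift_integral_curve M id N I"
  unfolding lift_integral_curve_def reparametrization_def
  using geodesic_imp_spray_integral_curve by blast

lemma geodesic_on_if_acceleration_normal:
  assumes "\<And>u. u \<in> J \<Longrightarrow> \<beta> u \<in> M" "\<And>u. u \<in> J \<Longrightarrow> \<beta> differentiable (at u)"
    and acc: "\<And>u. u \<in> J \<Longrightarrow> (velocity \<beta> has_vector_derivative r *\<^sub>R \<beta> u) (at u)"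
  shows "geodesic_on M id \<beta> J"
  unfolding geodesic_on_def
proof (intro ballI conjI)
  fix u assume u: "u \<in> J"
  show "velocity \<beta> differentiable (at u)" using acc[OF u] by (rule differentiableI_vector)
  have "vector_derivative (velocity \<beta>) (at u) = r *\<^sub>R \<beta> u"
    using acc[OF u] by (rule vector_derivative_at)
  moreover have "mink (\<beta> u) (\<beta> u) = \<epsilon>" using assms(1)[OF u] M by simp
  \<comment> \<open>One factor \<open>\<epsilon>\<close> comes from \<open>normal_sign\<close>, the
    other from the square of the position vector; they cancel for both signs.\<close>
  moreover have "\<epsilon> * (r * \<epsilon>) = r" using eps by (metis mult.left_commute mult.right_neutral)
  ultimately show "induced_covariant id \<beta> (velocity \<beta>) u = 0"
    by (simp add: induced_covariant_def normal_sign_def mink_simps)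
qed (use assms in auto)

text \<open>If \<open>\<phi>\<close> has derivative \<open>k / W (\<phi> u)\<close> with
  \<open>k\<close> constant, the velocity of \<open>N \<circ> \<phi>\<close> is
  \<open>k *\<^sub>R V (\<phi> u)\<close> and its acceleration is \<open>k * k * r\<close> times the
  position, hence normal. As \<open>q\<close> is constant, for nonzero \<open>q\<close> the arc
  length parameters are of this kind.\<close>

lemma traces_geodesic:
  assumes I: "open_interval I" and NM: "\<And>s. s \<in> I \<Longrightarrow> N s \<in> M"
    and W: "continuous_on I W" "\<And>s. s \<in> I \<Longrightarrow> W s > 0"
    and N': "\<And>s. s \<in> I \<Longrightarrow> (N has_vector_derivative W s *\<^sub>R V s) (at s)"
    and V': "\<And>s. s \<in> I \<Longrightarrow> (V has_vector_derivative (r * W s) *\<^sub>R N s) (at s)"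
    and q: "\<And>s. s \<in> I \<Longrightarrow> mink (V s) (V s) = q"
  shows "traces_geodesic M id N I"
proof -
  have velocity: "(\<beta> has_vector_derivative (d * W (\<phi> u)) *\<^sub>R V (\<phi> u)) (at u)"
    if J: "open_interval J" and \<phi>: "\<phi> ` J = I" and \<beta>: "\<And>u. u \<in> J \<Longrightarrow> \<beta> u = N (\<phi> u)"
      and u: "u \<in> J" and d: "(\<phi> has_real_derivative d) (at u)" for \<beta> J \<phi> d u
  proof -
    have "(N \<circ> \<phi> has_vector_derivative d *\<^sub>R (W (\<phi> u) *\<^sub>R V (\<phi> u))) (at u)"
      using d \<phi> u by (intro vector_diff_chain_at N')
        (auto simp: has_real_derivative_iff_has_vector_derivative)
    then show ?thesis
      using has_vector_derivative_transform_within_open[of "N \<circ> \<phi>" _ u J \<beta>] J u \<beta>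
      by (simp add: open_interval_def)
  qed
  have geodesic: "geodesic_on M id \<beta> J"
    if J: "open_interval J" and \<phi>: "\<phi> ` J = I" and \<beta>: "\<And>u. u \<in> J \<Longrightarrow> \<beta> u = N (\<phi> u)"
      and d: "\<And>u. u \<in> J \<Longrightarrow> (\<phi> has_real_derivative d u) (at u)"
      and k: "\<And>u. u \<in> J \<Longrightarrow> d u * W (\<phi> u) = k" for \<beta> J \<phi> d k
  proof (rule geodesic_on_if_acceleration_normal)
    fix u assume u: "u \<in> J"
    then show "\<beta> u \<in> M" using \<beta> \<phi> NM by auto
    have vel: "(\<beta> has_vector_derivative k *\<^sub>R V (\<phi> x)) (at x)" if "x \<in> J" for x
      using velocity[OF J \<phi> \<beta> that d[OF that]] k[OF that] by simp
    show "\<beta> differentiable (at u)" using vel[OF u] by (rule differentiableI_vector)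
    have "(V \<circ> \<phi> has_vector_derivative d u *\<^sub>R ((r * W (\<phi> u)) *\<^sub>R N (\<phi> u))) (at u)"
      using d[OF u] \<phi> u by (intro vector_diff_chain_at V')
        (auto simp: has_real_derivative_iff_has_vector_derivative)
    then have "((\<lambda>x. k *\<^sub>R V (\<phi> x)) has_vector_derivative
        k *\<^sub>R (d u *\<^sub>R ((r * W (\<phi> u)) *\<^sub>R N (\<phi> u)))) (at u)"
      unfolding o_def by (intro bounded_linear.has_vector_derivative[OF bounded_linear_scaleR_right])
    then have "(velocity \<beta> has_vector_derivative
        k *\<^sub>R (d u *\<^sub>R ((r * W (\<phi> u)) *\<^sub>R N (\<phi> u)))) (at u)"
      by (rule has_vector_derivative_transform_within_open[where S = J])
         (use J u vector_derivative_at[OF vel] in \<open>auto simp: open_interval_def velocity_def\<close>)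
    moreover have "k *\<^sub>R (d u *\<^sub>R ((r * W (\<phi> u)) *\<^sub>R N (\<phi> u))) = (k * k * r) *\<^sub>R \<beta> u"
      using k[OF u] \<beta>[OF u] by (simp add: mult_ac)
    ultimately show "(velocity \<beta> has_vector_derivative (k * k * r) *\<^sub>R \<beta> u) (at u)" by simp
  qed
  \<comment> \<open>The velocity \<open>k *\<^sub>R V (\<phi> u)\<close> has square
    \<open>k * k * q\<close>, which this \<open>k\<close> makes 1 or -1. For \<open>q = 0\<close>
    the curve is null and any positive constant would serve.\<close>
  define k where "k = (if q = 0 then 1 else 1 / sqrt \<bar>q\<bar>)"
  have kpos: "k > 0" by (simp add: k_def)
  have "\<exists>\<beta> J. reparametrization N I \<beta> J \<and> (unit_speed \<beta> J \<or> null_curve \<beta> J) \<and> geodesic_on M id \<beta> J"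
  proof -
    have "continuous_on I (\<lambda>s. W s / k)" using W(1) kpos by (intro continuous_intros) auto
    moreover have "W s / k > 0" if "s \<in> I" for s using W(2)[OF that] kpos by simp
    ultimately obtain \<phi> J where J: "open_interval J" "\<phi> ` J = I"
      and \<phi>: "\<And>u. u \<in> J \<Longrightarrow> (\<phi> has_real_derivative 1 / (W (\<phi> u) / k)) (at u)"
      using reparametrization_exists[OF I, of "\<lambda>s. W s / k"] by blast
    have Wpos: "W (\<phi> u) > 0" if "u \<in> J" for u using that J W(2) by auto
    have dk: "1 / (W (\<phi> u) / k) * W (\<phi> u) = k" if "u \<in> J" for u
      using Wpos[OF that] by simp
    have "geodesic_on M id (N \<circ> \<phi>) J"
      by (rule geodesic[OF J _ \<phi> dk]) simp_all
    moreover have "reparametrization N I (N \<circ> \<phi>) J"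
      unfolding reparametrization_def
      using J \<phi> Wpos kpos by (metis comp_apply divide_pos_pos zero_less_one)
    moreover have "mink (velocity (N \<circ> \<phi>) u) (velocity (N \<circ> \<phi>) u) = k * k * q" if "u \<in> J" for u
    proof -
      have "velocity (N \<circ> \<phi>) u = k *\<^sub>R V (\<phi> u)"
        using velocity[OF J _ that \<phi>[OF that], of "N \<circ> \<phi>"] dk[OF that]
        by (simp add: velocity_def vector_derivative_at)
      then show ?thesis using q J that by (auto simp: mink_simps)
    qed
    then have "unit_speed (N \<circ> \<phi>) J \<or> null_curve (N \<circ> \<phi>) J"
      by (cases "q = 0") (auto simp: unit_speed_def null_curve_def mnorm_def k_def abs_mult)
    ultimately show ?thesis by blast
  qed
  moreover have "geodesic_on M id \<beta> J" if \<beta>: "reparametrization N I \<beta> J" "unit_speed \<beta> J" for \<beta> J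
  proof -
    obtain \<phi> where J: "open_interval J" "\<phi> ` J = I"
      and \<phi>: "\<forall>u\<in>J. (\<exists>d>0. (\<phi> has_real_derivative d) (at u)) \<and> \<beta> u = N (\<phi> u)"
      using \<beta>(1) unfolding reparametrization_def by blast
    from \<phi> obtain d where d: "\<And>u. u \<in> J \<Longrightarrow> d u > 0"
        "\<And>u. u \<in> J \<Longrightarrow> (\<phi> has_real_derivative d u) (at u)"
      by metis
    have N: "\<beta> u = N (\<phi> u)" if "u \<in> J" for u using \<phi> that by blast
    \<comment> \<open>Unit speed leaves no freedom in the rate of \<open>\<phi>\<close>: the factor
      in front of \<open>V\<close> must be constant, so \<open>geodesic\<close> applies.\<close>
    have "d u * W (\<phi> u) = 1 / sqrt \<bar>q\<bar>" if u: "u \<in> J" for u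
    proof -
      have "velocity \<beta> u = (d u * W (\<phi> u)) *\<^sub>R V (\<phi> u)"
        using velocity[OF J N u d(2)[OF u]] by (simp add: velocity_def vector_derivative_at)
      moreover have "mink (V (\<phi> u)) (V (\<phi> u)) = q" using q J u by blast
      moreover have "d u * W (\<phi> u) > 0" using W(2) d(1) J u by auto
      ultimately have "mnorm (velocity \<beta> u) = (d u * W (\<phi> u)) * sqrt \<bar>q\<bar>"
        by (simp add: mnorm_scaleR mnorm_def[of "V (\<phi> u)"])
      then have "(d u * W (\<phi> u)) * sqrt \<bar>q\<bar> = 1" using \<beta>(2) u by (simp add: unit_speed_def)
      \<comment> \<open>For \<open>q = 0\<close> the speed would be 0, so that case is
        contradictory.\<close>
      then show ?thesis by (cases "q = 0") (auto simp: field_simps)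
    qed
    then show ?thesis using geodesic[OF J N d(2)] by blast
  qed
  ultimately show ?thesis using NM by (auto simp: traces_geodesic_def)
qed

end

section \<open>Differentiability of the hyperbolic angle\<close>

lemma hyperbolic_angle_has_derivative:
  fixes \<theta> f w :: "real \<Rightarrow> real"
  assumes I: "open I" "s \<in> I" and w: "\<And>u. u \<in> I \<Longrightarrow> w u > 0"
    and f: "\<And>u. u \<in> I \<Longrightarrow> f u = w u * sinh (\<theta> u)"
    and diff: "f differentiable (at s)" "w differentiable (at s)"
  shows "(\<theta> has_real_derivative deriv \<theta> s) (at s)"
proof -
  have "w s \<noteq> 0" using w I by force
  then have "(\<lambda>u. f u / w u) differentiable (at s)" using diff by simp
  then obtain D where "((\<lambda>u. f u / w u) has_real_derivative D) (at s)"
    using real_differentiableE by blast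
  \<comment> \<open>On \<open>I\<close> the angle is \<open>arsinh (f u / w u)\<close>, so it
    inherits differentiability from \<open>f\<close> and \<open>w\<close>, and
    \<open>deriv \<theta> s\<close> is a genuine derivative.\<close>
  then have "((\<lambda>u. arsinh (f u / w u)) has_real_derivative 1 / sqrt ((f s / w s)\<^sup>2 + 1) * D) (at s)"
    by (intro DERIV_chain2[OF arsinh_real_has_field_derivative])
  then have "(\<theta> has_real_derivative 1 / sqrt ((f s / w s)\<^sup>2 + 1) * D) (at s)"
  proof (rule has_field_derivative_transform_within_open[OF _ I])
    fix u assume "u \<in> I"
    then show "arsinh (f u / w u) = \<theta> u" using f w[of u] by (simp add: arsinh_sinh_real)
  qed
  then show ?thesis by (simp add: DERIV_imp_deriv)
qed

section \<open>The Frenet frame and the length of the Darboux vector\<close>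

locale frenet_curve =
  fixes I :: "real set" and \<alpha> t n b :: "real \<Rightarrow> real^3" and \<kappa> \<tau> :: "real \<Rightarrow> real"
  assumes I: "open_interval I" and frenet: "frenet_timelike_binormal I \<alpha> t n b \<kappa> \<tau>"
begin

lemma frame_derivatives:
  assumes "s \<in> I"
  shows "(t has_vector_derivative \<kappa> s *\<^sub>R n s) (at s)"
    and "(n has_vector_derivative - \<kappa> s *\<^sub>R t s + \<tau> s *\<^sub>R b s) (at s)"
    and "(b has_vector_derivative \<tau> s *\<^sub>R n s) (at s)"
    and "\<kappa> differentiable (at s)" "\<tau> differentiable (at s)"
  using frenet assms by (auto simp: frenet_timelike_binormal_def)

lemma frame_products:
  assumes "s \<in> I"
  shows "mink (t s) (t s) = 1" "mink (n s) (n s) = 1" "mink (b s) (b s) = -1"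
    "mink (t s) (n s) = 0" "mink (t s) (b s) = 0" "mink (n s) (b s) = 0"
    "mink (n s) (t s) = 0" "mink (b s) (t s) = 0" "mink (b s) (n s) = 0"
  using frenet assms by (auto simp: frenet_timelike_binormal_def mink_commute)

abbreviation w :: "real \<Rightarrow> real" where "w s \<equiv> mnorm (darboux t b \<kappa> \<tau> s)"

lemma darboux_norm:
  assumes "s \<in> I"
  shows "w s = sqrt \<bar>(\<tau> s)\<^sup>2 - (\<kappa> s)\<^sup>2\<bar>"
  using frame_products[OF assms]
  by (simp add: mnorm_def darboux_def mink_simps power2_eq_square)

lemma darboux_norm_pos:
  assumes "s \<in> I" "\<bar>\<kappa> s\<bar> \<noteq> \<bar>\<tau> s\<bar>"
  shows "w s > 0"
  using assms by (simp add: darboux_norm power2_eq_iff abs_eq_iff)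

text \<open>The radicand stays away from 0, where absolute value and square root are both
  differentiable; this treats both causal types at once. The result gives differentiability of the
  angle and the continuity required for changing the parameter.\<close>

lemma darboux_norm_differentiable:
  assumes ne: "\<And>u. u \<in> I \<Longrightarrow> \<bar>\<kappa> u\<bar> \<noteq> \<bar>\<tau> u\<bar>" and s: "s \<in> I"
  shows "w differentiable (at s)"
proof -
  obtain k' where k': "(\<kappa> has_real_derivative k') (at s)"
    using frame_derivatives(4)[OF s] real_differentiableE by blast
  obtain t' where t': "(\<tau> has_real_derivative t') (at s)"
    using frame_derivatives(5)[OF s] real_differentiableE by blast
  have nz: "(\<tau> s)\<^sup>2 - (\<kappa> s)\<^sup>2 \<noteq> 0" using ne[OF s] by (auto simp: power2_eq_iff abs_eq_iff)
  have "((\<lambda>u. (\<tau> u)\<^sup>2 - (\<kappa> u)\<^sup>2) has_real_derivative 2 * \<tau> s * t' - 2 * \<kappa> s * k') (at s)"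
    by (auto intro!: derivative_eq_intros k' t')
  then have "(\<lambda>u. (\<tau> u)\<^sup>2 - (\<kappa> u)\<^sup>2) differentiable (at s)"
    using real_differentiable_def by blast
  moreover have "(\<lambda>x::real. sqrt \<bar>x\<bar>) differentiable (at x)" if x: "x \<noteq> 0" for x
  proof -
    obtain D where "((\<lambda>x::real. \<bar>x\<bar>) has_real_derivative D) (at x)"
      using differentiable_norm_at[OF x] unfolding real_norm_def[abs_def] real_differentiable_def
      by blast
    then have "((\<lambda>x::real. sqrt \<bar>x\<bar>) has_real_derivative inverse (sqrt \<bar>x\<bar>) / 2 * D) (at x)"
      using x by (intro DERIV_chain2[OF DERIV_real_sqrt]) auto
    then show ?thesis using real_differentiable_def by blast
  qed
  ultimately have "(\<lambda>u. sqrt \<bar>(\<tau> u)\<^sup>2 - (\<kappa> u)\<^sup>2\<bar>) differentiable (at s)"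
    using nz differentiable_chain_at[of "\<lambda>u. (\<tau> u)\<^sup>2 - (\<kappa> u)\<^sup>2" s "\<lambda>x. sqrt \<bar>x\<bar>"]
    by (simp add: o_def)
  then obtain D where "((\<lambda>u. sqrt \<bar>(\<tau> u)\<^sup>2 - (\<kappa> u)\<^sup>2\<bar>) has_real_derivative D) (at s)"
    using real_differentiableE by blast
  then have "(w has_real_derivative D) (at s)"
    by (rule has_field_derivative_transform_within_open[where S = I])
       (use I s darboux_norm in \<open>auto simp: open_interval_def\<close>)
  then show ?thesis using real_differentiable_def by blast
qed

section \<open>The two causal types of the Darboux vector\<close>

lemma spacelike_darboux:
  assumes \<kappa>\<tau>: "\<And>s. s \<in> I \<Longrightarrow> \<bar>\<kappa> s\<bar> < \<bar>\<tau> s\<bar>"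
    and \<theta>: "\<And>s. s \<in> I \<Longrightarrow> \<kappa> s = w s * sinh (\<theta> s)" "\<And>s. s \<in> I \<Longrightarrow> \<tau> s = w s * cosh (\<theta> s)"
    and N: "\<And>s. s \<in> I \<Longrightarrow> N s = sinh (\<theta> s) *\<^sub>R t s - cosh (\<theta> s) *\<^sub>R b s"
    and \<gamma>: "geod_curv_S (darboux t b \<kappa> \<tau>) \<theta> constant_on I"
  shows "traces_geodesic hyperbolic_sphere id N I \<and> lift_integral_curve hyperbolic_sphere id N I"
proof -
  interpret unit_sphere hyperbolic_sphere "-1"
    by unfold_locales (simp_all add: hyperbolic_sphere_def)
  have oI: "open I" using I by (simp add: open_interval_def)
  have ne: "\<bar>\<kappa> s\<bar> \<noteq> \<bar>\<tau> s\<bar>" if "s \<in> I" for s using \<kappa>\<tau>[OF that] by simp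
  have w: "w s > 0" "w differentiable (at s)" if "s \<in> I" for s
    using darboux_norm_pos ne darboux_norm_differentiable that by blast+
  obtain g where g: "deriv \<theta> s / w s = g" if "s \<in> I" for s
    using \<gamma> unfolding constant_on_def geod_curv_S_def by blast
  \<comment> \<open>Constant geodesic curvature makes the derivative of the angle a constant
    multiple of \<open>w s\<close>, so that \<open>w s\<close> can be factored out of all
    derivatives below.\<close>
  have \<theta>': "(\<theta> has_real_derivative g * w s) (at s)" if s: "s \<in> I" for s
    using hyperbolic_angle_has_derivative[OF oI s w(1) \<theta>(1) frame_derivatives(4)[OF s] w(2)[OF s]]
      g[OF s] w(1)[OF s] by (auto simp: field_simps)
  have hyp: "cosh (\<theta> s) * cosh (\<theta> s) = 1 + sinh (\<theta> s) * sinh (\<theta> s)" for s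
    using hyperbolic_pythagoras[of "\<theta> s"] by (simp add: power2_eq_square)
  \<comment> \<open>The bracket is the unit spacelike vector completing \<open>N\<close> and
    \<open>n\<close> to an orthogonal frame. Differentiation with respect to the angle alone
    interchanges it with \<open>N\<close>.\<close>
  define V where "V s = g *\<^sub>R (cosh (\<theta> s) *\<^sub>R t s - sinh (\<theta> s) *\<^sub>R b s) - n s" for s
  have "traces_geodesic hyperbolic_sphere id N I"
  proof (rule traces_geodesic[OF I])
    fix s assume s: "s \<in> I"
    note fd = frame_derivatives[OF s] and fp = frame_products[OF s]
    show "N s \<in> hyperbolic_sphere"
      by (simp add: hyperbolic_sphere_def N[OF s] mink_simps fp hyp)
    show "w s > 0" using w s by blast
    have D: "((\<lambda>s. sinh (\<theta> s) *\<^sub>R t s - cosh (\<theta> s) *\<^sub>R b s) has_vector_derivative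
        (g * w s) *\<^sub>R (cosh (\<theta> s) *\<^sub>R t s - sinh (\<theta> s) *\<^sub>R b s)
          - (w s * (cosh (\<theta> s) * cosh (\<theta> s) - sinh (\<theta> s) * sinh (\<theta> s))) *\<^sub>R n s) (at s)"
      by (rule has_vector_derivative_eq_rhs, (rule derivative_intros fd \<theta>'[OF s])+)
         (simp add: \<theta>[OF s] algebra_simps)
    show "(N has_vector_derivative w s *\<^sub>R V s) (at s)"
      by (rule has_vector_derivative_transform_within_open[OF _ oI s],
          rule has_vector_derivative_eq_rhs[OF D])
         (simp_all add: N V_def hyp scaleR_diff_right mult_ac)
    \<comment> \<open>The \<open>n\<close> components arising from the derivatives of
      \<open>t\<close> and \<open>b\<close> cancel, since \<open>\<kappa> s * cosh (\<theta> s) =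
      \<tau> s * sinh (\<theta> s)\<close>. The second summand is minus the derivative of
      \<open>n\<close>.\<close>
    have "(V has_vector_derivative g *\<^sub>R ((g * w s) *\<^sub>R (sinh (\<theta> s) *\<^sub>R t s - cosh (\<theta> s) *\<^sub>R b s))
        + w s *\<^sub>R (sinh (\<theta> s) *\<^sub>R t s - cosh (\<theta> s) *\<^sub>R b s)) (at s)"
      unfolding V_def
      by (rule has_vector_derivative_eq_rhs, (rule derivative_intros fd \<theta>'[OF s])+)
         (simp add: \<theta>[OF s] algebra_simps)
    then show "(V has_vector_derivative ((1 + g\<^sup>2) * w s) *\<^sub>R N s) (at s)"
      by (simp add: N[OF s] algebra_simps power2_eq_square)
    \<comment> \<open>The square is positive, so the null case does not arise on the hyperbolic
      sphere.\<close>
    show "mink (V s) (V s) = 1 + g\<^sup>2"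
      by (simp add: V_def mink_simps fp hyp algebra_simps power2_eq_square)
  next
    show "continuous_on I w"
      using w(2) by (meson differentiable_imp_continuous_within continuous_at_imp_continuous_on)
  qed
  then show ?thesis using lift_integral_curve by blast
qed

text \<open>The scheme is that of the spacelike case, but the vector completing \<open>N\<close> and
  \<open>n\<close> to a frame is now timelike, and the derivative of \<open>n\<close> is
  \<open>w s\<close> times \<open>N\<close> instead of its negative. Both changes of sign show in
  the constants for \<open>V\<close>.\<close>

lemma timelike_darboux:
  assumes \<kappa>\<tau>: "\<And>s. s \<in> I \<Longrightarrow> \<bar>\<kappa> s\<bar> > \<bar>\<tau> s\<bar>"
    and \<theta>: "\<And>s. s \<in> I \<Longrightarrow> \<kappa> s = w s * cosh (\<theta> s)" "\<And>s. s \<in> I \<Longrightarrow> \<tau> s = w s * sinh (\<theta> s)"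
    and N: "\<And>s. s \<in> I \<Longrightarrow> N s = - cosh (\<theta> s) *\<^sub>R t s + sinh (\<theta> s) *\<^sub>R b s"
    and \<gamma>: "geod_curv_S (darboux t b \<kappa> \<tau>) \<theta> constant_on I"
  shows "traces_geodesic lorentz_sphere id N I \<and> lift_integral_curve lorentz_sphere id N I"
proof -
  interpret unit_sphere lorentz_sphere 1
    by unfold_locales (simp_all add: lorentz_sphere_def)
  have oI: "open I" using I by (simp add: open_interval_def)
  have ne: "\<bar>\<kappa> s\<bar> \<noteq> \<bar>\<tau> s\<bar>" if "s \<in> I" for s using \<kappa>\<tau>[OF that] by simp
  have w: "w s > 0" "w differentiable (at s)" if "s \<in> I" for s
    using darboux_norm_pos ne darboux_norm_differentiable that by blast+
  obtain g where g: "deriv \<theta> s / w s = g" if "s \<in> I" for s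
    using \<gamma> unfolding constant_on_def geod_curv_S_def by blast
  have \<theta>': "(\<theta> has_real_derivative g * w s) (at s)" if s: "s \<in> I" for s
    \<comment> \<open>Here it is the torsion that carries the hyperbolic sine, so the angle is
      recovered from \<open>\<tau>\<close>.\<close>
    using hyperbolic_angle_has_derivative[OF oI s w(1) \<theta>(2) frame_derivatives(5)[OF s] w(2)[OF s]]
      g[OF s] w(1)[OF s] by (auto simp: field_simps)
  have hyp: "cosh (\<theta> s) * cosh (\<theta> s) = 1 + sinh (\<theta> s) * sinh (\<theta> s)" for s
    using hyperbolic_pythagoras[of "\<theta> s"] by (simp add: power2_eq_square)
  define V where "V s = g *\<^sub>R (- sinh (\<theta> s) *\<^sub>R t s + cosh (\<theta> s) *\<^sub>R b s) - n s" for s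
  have "traces_geodesic lorentz_sphere id N I"
  proof (rule traces_geodesic[OF I])
    fix s assume s: "s \<in> I"
    note fd = frame_derivatives[OF s] and fp = frame_products[OF s]
    show "N s \<in> lorentz_sphere"
      by (simp add: lorentz_sphere_def N[OF s] mink_simps fp hyp)
    show "w s > 0" using w s by blast
    have D: "((\<lambda>s. - cosh (\<theta> s) *\<^sub>R t s + sinh (\<theta> s) *\<^sub>R b s) has_vector_derivative
        (g * w s) *\<^sub>R (- sinh (\<theta> s) *\<^sub>R t s + cosh (\<theta> s) *\<^sub>R b s)
          - (w s * (cosh (\<theta> s) * cosh (\<theta> s) - sinh (\<theta> s) * sinh (\<theta> s))) *\<^sub>R n s) (at s)"
      by (rule has_vector_derivative_eq_rhs, (rule derivative_intros fd \<theta>'[OF s])+)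
         (simp add: \<theta>[OF s] algebra_simps)
    show "(N has_vector_derivative w s *\<^sub>R V s) (at s)"
      by (rule has_vector_derivative_transform_within_open[OF _ oI s],
          rule has_vector_derivative_eq_rhs[OF D])
         (simp_all add: N V_def hyp scaleR_diff_right mult_ac)
    have "(V has_vector_derivative g *\<^sub>R ((g * w s) *\<^sub>R (- cosh (\<theta> s) *\<^sub>R t s + sinh (\<theta> s) *\<^sub>R b s))
        - w s *\<^sub>R (- cosh (\<theta> s) *\<^sub>R t s + sinh (\<theta> s) *\<^sub>R b s)) (at s)"
      unfolding V_def
      by (rule has_vector_derivative_eq_rhs, (rule derivative_intros fd \<theta>'[OF s])+)
         (simp add: \<theta>[OF s] algebra_simps)
    then show "(V has_vector_derivative ((g\<^sup>2 - 1) * w s) *\<^sub>R N s) (at s)"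
      by (simp add: N[OF s] algebra_simps power2_eq_square)
    \<comment> \<open>This vanishes when \<open>g\<close> is 1 or -1. Then the factor
      \<open>g\<^sup>2 - 1\<close> vanishes too, \<open>V\<close> is constant, and \<open>N\<close>
      runs along a null straight line of the Lorentzian sphere.\<close>
    show "mink (V s) (V s) = 1 - g\<^sup>2"
      by (simp add: V_def mink_simps fp hyp algebra_simps power2_eq_square)
  next
    show "continuous_on I w"
      using w(2) by (meson differentiable_imp_continuous_within continuous_at_imp_continuous_on)
  qed
  then show ?thesis using lift_integral_curve by blast
qed

end

theorem mainTheorem2:
  fixes \<alpha> t n b \<omega> tstar nstar :: "real \<Rightarrow> real^3"
    and \<kappa> \<tau> \<theta> :: "real \<Rightarrow> real"
    and c :: real and I :: "real set"
  assumes I: "open_interval I"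
    and alpha: "frenet_timelike_binormal I \<alpha> t n b \<kappa> \<tau>"
    and omega: "\<omega> = darboux t b \<kappa> \<tau>"
    and frame: "tangent_normal_frame I (involute \<alpha> t c) tstar nstar"
    and tstar: "\<forall>s\<in>I. tstar s = n s"
    and gamma_n: "geod_curv_S \<omega> \<theta> constant_on I"
    and k_n: "geod_curv_E \<omega> n constant_on I"
  shows
    "((\<forall>s\<in>I. spacelike (\<omega> s) \<and> \<bar>\<kappa> s\<bar> < \<bar>\<tau> s\<bar>
         \<and> \<kappa> s = mnorm (\<omega> s) * sinh (\<theta> s) \<and> \<tau> s = mnorm (\<omega> s) * cosh (\<theta> s)
         \<and> nstar s = sinh (\<theta> s) *\<^sub>R t s - cosh (\<theta> s) *\<^sub>R b s)
       \<longrightarrow> traces_geodesic hyperbolic_sphere id nstar I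
           \<and> lift_integral_curve hyperbolic_sphere id nstar I)
     \<and>
     ((\<forall>s\<in>I. timelike (\<omega> s) \<and> \<bar>\<kappa> s\<bar> > \<bar>\<tau> s\<bar>
         \<and> \<kappa> s = mnorm (\<omega> s) * cosh (\<theta> s) \<and> \<tau> s = mnorm (\<omega> s) * sinh (\<theta> s)
         \<and> nstar s = - cosh (\<theta> s) *\<^sub>R t s + sinh (\<theta> s) *\<^sub>R b s)
       \<longrightarrow> traces_geodesic lorentz_sphere id nstar I
           \<and> lift_integral_curve lorentz_sphere id nstar I)"
proof -
  interpret frenet_curve I \<alpha> t n b \<kappa> \<tau>
    using I alpha by unfold_locales
  \<comment> \<open>Unfolding \<open>omega\<close> turns \<open>mnorm (\<omega> s)\<close> into
    \<open>w s\<close>, so each conjunct matches one of the two causal cases.\<close>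
  show ?thesis
    using spacelike_darboux[of \<theta> nstar] timelike_darboux[of \<theta> nstar] gamma_n
    unfolding omega by blast
qed

end
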